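(* Let $K$ be a field, $n\ge 1$, $S=K[x_1,\ldots,x_n]$, $T=K[x_1,\ldots,x_{n-1}]$, and let $\varphi\colon S\to T$ be the $K$-algebra homomorphism with $x_i\mapsto x_i$ for $i=1,\ldots,n-1$ and $x_n\mapsto 1$. Let $I\subset S$ be a monomial ideal and let $$\mathcal P:\ I=I_0\subset I_1\subset I_2\subset\cdots\subset I_r=S$$ be a prime filtration of $S/I$ with $\mathbb Z^n$-graded isomorphisms $I_j/I_{j-1}\cong (S/P_j)(-a_j)$ for $j=1,\ldots,r$, where each $P_j$ is a monomial prime ideal of $S$ and $a_j\in\mathbb Z^n$. Set $J=\varphi(I)$ and $J_j=\varphi(I_j)$ for $j=0,\ldots,r$. Then $$J=J_0\subseteq J_1\subseteq J_2\subseteq\cdots\subseteq J_r=T$$ is a filtration such that for every $j=1,\ldots,r$ there is an isomorphism of $\mathbb Z^{n-1}$-graded $T$-modules $$J_j/J_{j-1}\cong\begin{cases}(T/P_j')(-a_j'), & \text{if } x_n\notin P_j,\\ 0, & \text{if } x_n\in P_j,\end{cases}$$ where, when $x_n\notin P_j$, $P_j'\subset T$ is the monomial prime ideal of $T$ such that $P_j=P_j'S$, and $a_j'=\pi(a_j)\in\mathbb Z^{n-1}$ is the vector obtained from $a_j$ by deleting its last coordinate.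
   Context: A monomial ideal is an ideal generated by monomials. A monomial prime ideal is a prime ideal generated by a (possibly empty) subset of the variables. A prime filtration of $S/I$ is a chain of monomial ideals $I=I_0\subset I_1\subset\cdots\subset I_r=S$ such that for each $j=1,\ldots,r$ there is an isomorphism of $\mathbb Z^n$-graded $S$-modules $I_j/I_{j-1}\cong (S/P_j)(-a_j)$ with $P_j$ a monomial prime ideal and $a_j\in\mathbb Z^n$. Here $S$ carries the fine grading $\deg x_i=e_i$ and $M(-a)$ denotes the graded module with $M(-a)_b=M_{b-a}$; similarly $T$ is $\mathbb Z^{n-1}$-graded. The projection $\pi\colon\mathbb Z^n\to\mathbb Z^{n-1}$ is $\pi(a_1,\ldots,a_n)=(a_1,\ldots,a_{n-1})$. Since $\varphi$ is surjective, the image under $\varphi$ of a monomial ideal of $S$ is a monomial ideal of $T$. *)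

theory Defs
  imports "HOL-Library.Poly_Mapping" "HOL-Algebra.Module" "HOL-Algebra.RingHom"
begin

section \<open>Polynomial rings\<close>

text \<open>
  Exponent vectors are finitely supported functions on the variable indices, and polynomials are
  finitely supported functions on exponent vectors. The ring \<open>K[x\<^sub>1,\<dots>,x\<^sub>n]\<close> is the subring
  of those polynomials that involve only the variables with indices in \<open>{1..n}\<close>. In particular
  \<open>K[x\<^sub>1,\<dots>,x\<^bsub>n-1\<^esub>]\<close> is literally a subset of \<open>K[x\<^sub>1,\<dots>,x\<^sub>n]\<close>, and \<open>n = 0\<close> gives \<open>K\<close>.
\<close>

type_synonym 'k mpoly = "(nat \<Rightarrow>\<^sub>0 nat) \<Rightarrow>\<^sub>0 'k"

definition exponents :: "nat \<Rightarrow> (nat \<Rightarrow>\<^sub>0 nat) set" where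
  "exponents n = {m. Poly_Mapping.keys m \<subseteq> {1..n}}"

definition mpoly_ring :: "nat \<Rightarrow> 'k::field mpoly ring" where
  "mpoly_ring n = \<lparr>carrier = {p. Poly_Mapping.keys p \<subseteq> exponents n},
     monoid.mult = (*), one = 1, zero = 0, add = (+)\<rparr>"

definition mconst :: "'k::field \<Rightarrow> 'k mpoly" where
  "mconst c = Poly_Mapping.single 0 c"

definition monomial :: "(nat \<Rightarrow>\<^sub>0 nat) \<Rightarrow> 'k::field mpoly" where
  "monomial m = Poly_Mapping.single m 1"

definition mvar :: "nat \<Rightarrow> 'k::field mpoly" where
  "mvar i = monomial (Poly_Mapping.single i 1)"

definition algebra_hom :: "nat \<Rightarrow> nat \<Rightarrow> ('k::field mpoly \<Rightarrow> 'k mpoly) set" where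
  "algebra_hom n m =
     {f \<in> ring_hom (mpoly_ring n) (mpoly_ring m). \<forall>c. f (mconst c) = mconst c}"

definition monomial_ideal :: "nat \<Rightarrow> 'k::field mpoly set \<Rightarrow> bool" where
  "monomial_ideal n I \<longleftrightarrow> (\<exists>A \<subseteq> monomial ` exponents n. I = genideal (mpoly_ring n) A)"

definition monomial_prime_ideal :: "nat \<Rightarrow> 'k::field mpoly set \<Rightarrow> bool" where
  "monomial_prime_ideal n P \<longleftrightarrow>
     primeideal P (mpoly_ring n) \<and> (\<exists>A \<subseteq> {1..n}. P = genideal (mpoly_ring n) (mvar ` A))"


section \<open>Multigraded modules\<close>

text \<open>
  The group \<open>\<int>\<^sup>n\<close> is the group of finitely supported integer functions that vanish outside
  \<open>{1..n}\<close>. A graded module is a module together with the family of its homogeneous components;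
  only the components at degrees in \<open>\<int>\<^sup>n\<close> are meaningful for modules over \<open>K[x\<^sub>1,\<dots>,x\<^sub>n]\<close>.
\<close>

definition degrees :: "nat \<Rightarrow> (nat \<Rightarrow>\<^sub>0 int) set" where
  "degrees n = {d. Poly_Mapping.keys d \<subseteq> {1..n}}"

definition drop_coord :: "nat \<Rightarrow> (nat \<Rightarrow>\<^sub>0 int) \<Rightarrow> (nat \<Rightarrow>\<^sub>0 int)" where
  "drop_coord n d = Poly_Mapping.update n 0 d"

record ('r, 'm, 'd) graded_module = "('r, 'm) module" +
  component :: "'d \<Rightarrow> 'm set"

text \<open>
  As for every record of type \<open>module\<close>, the fields \<open>mult\<close> and \<open>one\<close> carry no meaning for a module;
  they are left \<open>undefined\<close>.
\<close>

definition ideal_module ::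
    "'k::field mpoly set \<Rightarrow> ('k mpoly, 'k mpoly, nat \<Rightarrow>\<^sub>0 int) graded_module" where
  "ideal_module I = \<lparr>carrier = I, monoid.mult = undefined, one = undefined,
     zero = 0, add = (+), smult = (*),
     component = (\<lambda>d. {p \<in> I. \<forall>m \<in> Poly_Mapping.keys p. Poly_Mapping.map int m = d})\<rparr>"

definition quotient_module ::
    "('r, 'm, 'd) graded_module \<Rightarrow> 'm set \<Rightarrow> ('r, 'm set, 'd) graded_module" where
  "quotient_module M N = \<lparr>carrier = a_rcosets\<^bsub>M\<^esub> N,
     monoid.mult = undefined, one = undefined,
     zero = N, add = set_add M, smult = (\<lambda>r C. \<Union>x\<in>C. N +>\<^bsub>M\<^esub> (r \<odot>\<^bsub>M\<^esub> x)),
     component = (\<lambda>d. (\<lambda>x. N +>\<^bsub>M\<^esub> x) ` component M d)\<rparr>"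

text \<open>\<open>twist M a\<close> is \<open>M(-a)\<close>.\<close>

definition twist ::
    "('r, 'm, 'd::ab_group_add) graded_module \<Rightarrow> 'd \<Rightarrow> ('r, 'm, 'd) graded_module" where
  "twist M a = M\<lparr>component := (\<lambda>b. component M (b - a))\<rparr>"

definition zero_module :: "('r, unit, 'd) graded_module" where
  "zero_module = \<lparr>carrier = {()}, monoid.mult = undefined, one = undefined,
     zero = (), add = (\<lambda>_ _. ()), smult = (\<lambda>_ _. ()), component = (\<lambda>_. {()})\<rparr>"

definition graded_iso :: "nat \<Rightarrow> ('k::field mpoly, 'm, nat \<Rightarrow>\<^sub>0 int) graded_module
    \<Rightarrow> ('k mpoly, 'l, nat \<Rightarrow>\<^sub>0 int) graded_module \<Rightarrow> bool" where
  "graded_iso n M N \<longleftrightarrow> (\<exists>f. bij_betw f (carrier M) (carrier N) \<and>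
     (\<forall>x\<in>carrier M. \<forall>y\<in>carrier M. f (x \<oplus>\<^bsub>M\<^esub> y) = f x \<oplus>\<^bsub>N\<^esub> f y) \<and>
     (\<forall>r\<in>carrier (mpoly_ring n). \<forall>x\<in>carrier M. f (r \<odot>\<^bsub>M\<^esub> x) = r \<odot>\<^bsub>N\<^esub> f x) \<and>
     (\<forall>d\<in>degrees n. f ` component M d = component N d))"

text \<open>\<open>(S/P)(-a)\<close> for \<open>S = K[x\<^sub>1,\<dots>,x\<^sub>n]\<close>.\<close>

abbreviation cyclic_module :: "nat \<Rightarrow> 'k::field mpoly set \<Rightarrow> (nat \<Rightarrow>\<^sub>0 int)
    \<Rightarrow> ('k mpoly, 'k mpoly set, nat \<Rightarrow>\<^sub>0 int) graded_module" where
  "cyclic_module n P a \<equiv> twist (quotient_module (ideal_module (carrier (mpoly_ring n))) P) a"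

definition prime_filtration :: "nat \<Rightarrow> 'k::field mpoly set \<Rightarrow> nat \<Rightarrow> (nat \<Rightarrow> 'k mpoly set)
    \<Rightarrow> (nat \<Rightarrow> 'k mpoly set) \<Rightarrow> (nat \<Rightarrow> (nat \<Rightarrow>\<^sub>0 int)) \<Rightarrow> bool" where
  "prime_filtration n I r F P a \<longleftrightarrow>
     F 0 = I \<and> F r = carrier (mpoly_ring n) \<and>
     (\<forall>j\<le>r. monomial_ideal n (F j)) \<and>
     (\<forall>j\<in>{1..r}. F (j - 1) \<subset> F j \<and> monomial_prime_ideal n (P j) \<and> a j \<in> degrees n \<and>
        graded_iso n (quotient_module (ideal_module (F j)) (F (j - 1)))
          (cyclic_module n (P j) (a j)))"


section \<open>Basic facts\<close>

lemma exponents_add: "m \<in> exponents n \<Longrightarrow> m' \<in> exponents n \<Longrightarrow> m + m' \<in> exponents n"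
  unfolding exponents_def using Poly_Mapping.keys_add[of m m'] by blast

lemma cring_mpoly_ring: "cring (mpoly_ring n :: 'k::field mpoly ring)"
proof -
  let ?C = "{p :: 'k mpoly. Poly_Mapping.keys p \<subseteq> exponents n}"
  have plus: "p + q \<in> ?C" if "p \<in> ?C" "q \<in> ?C" for p q
    using that Poly_Mapping.keys_add[of p q] by auto
  have times: "p * q \<in> ?C" if "p \<in> ?C" "q \<in> ?C" for p q
    using that keys_mult[of p q] exponents_add by blast
  have unit: "1 \<in> ?C"
    by (simp add: exponents_def flip: single_one)
  show ?thesis
  proof (rule cringI)
    show "abelian_group (mpoly_ring n :: 'k mpoly ring)"
    proof (rule abelian_groupI)
      fix p :: "'k mpoly" assume "p \<in> carrier (mpoly_ring n)"
      then show "\<exists>q\<in>carrier (mpoly_ring n). q \<oplus>\<^bsub>mpoly_ring n\<^esub> p = \<zero>\<^bsub>mpoly_ring n\<^esub>"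
        by (intro bexI[of _ "- p"]) (auto simp: mpoly_ring_def)
    qed (use plus in \<open>auto simp: mpoly_ring_def add_ac\<close>)
    show "Group.comm_monoid (mpoly_ring n :: 'k mpoly ring)"
      by (rule comm_monoidI) (use times unit in \<open>auto simp: mpoly_ring_def mult_ac\<close>)
  qed (auto simp: mpoly_ring_def distrib_right)
qed

text \<open>The substitution \<open>x\<^sub>n \<mapsto> 1\<close> exists.\<close>

lemma exists_substitution_hom:
  assumes "n \<ge> 1"
  shows "\<exists>\<phi>::'k::field mpoly \<Rightarrow> 'k mpoly. \<phi> \<in> algebra_hom n (n - 1) \<and>
    (\<forall>i\<in>{1..n-1}. \<phi> (mvar i) = mvar i) \<and> \<phi> (mvar n) = 1"
proof -
  define D :: "(nat \<Rightarrow>\<^sub>0 nat) \<Rightarrow> (nat \<Rightarrow>\<^sub>0 nat)" where "D = Poly_Mapping.update n 0"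
  have D_add: "D (m + m') = D m + D m'" for m m'
    unfolding D_def by (rule poly_mapping_eqI) (simp add: lookup_add update.rep_eq)
  have D_0: "D 0 = 0"
    unfolding D_def by (rule poly_mapping_eqI) (simp add: update.rep_eq)
  have D_mvar: "D (Poly_Mapping.single i 1) = (if i = n then 0 else Poly_Mapping.single i 1)" for i
    unfolding D_def
    by (rule poly_mapping_eqI) (auto simp: update.rep_eq lookup_single when_def)
  have D_exponents: "D m \<in> exponents (n - 1)" if m: "m \<in> exponents n" for m
  proof -
    have "i \<in> {1..n-1}" if i: "i \<in> Poly_Mapping.keys (D m)" for i
    proof -
      from i have "i \<noteq> n" "i \<in> Poly_Mapping.keys m"
        by (auto simp: D_def in_keys_iff update.rep_eq split: if_splits)
      moreover from this m have "i \<in> {1..n}"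
        unfolding exponents_def by blast
      ultimately show ?thesis by auto
    qed
    then show ?thesis unfolding exponents_def by blast
  qed
  define \<phi> :: "'k mpoly \<Rightarrow> 'k mpoly"
    where "\<phi> p = (\<Sum>m\<in>Poly_Mapping.keys p. Poly_Mapping.single (D m) (Poly_Mapping.lookup p m))"
    for p
  have \<phi>_sum: "\<phi> p = (\<Sum>m\<in>A. Poly_Mapping.single (D m) (Poly_Mapping.lookup p m))"
    if "finite A" "Poly_Mapping.keys p \<subseteq> A" for p A
    unfolding \<phi>_def using that
    by (intro sum.mono_neutral_left) (auto simp: in_keys_iff)
  have \<phi>_add: "\<phi> (p + q) = \<phi> p + \<phi> q" for p q
  proof -
    let ?A = "Poly_Mapping.keys p \<union> Poly_Mapping.keys q"
    have "\<phi> (p + q) = (\<Sum>m\<in>?A. Poly_Mapping.single (D m) (Poly_Mapping.lookup (p + q) m))"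
      by (rule \<phi>_sum) (use Poly_Mapping.keys_add[of p q] in auto)
    then show ?thesis
      using \<phi>_sum[of ?A p] \<phi>_sum[of ?A q]
      by (simp add: lookup_add single_add sum.distrib)
  qed
  have \<phi>_single: "\<phi> (Poly_Mapping.single m c) = Poly_Mapping.single (D m) c" for m c
    by (cases "c = 0") (auto simp: \<phi>_def)
  have \<phi>_0: "\<phi> 0 = 0" by (simp add: \<phi>_def)
  have \<phi>_setsum: "\<phi> (sum g A) = (\<Sum>x\<in>A. \<phi> (g x))" if "finite A" for g and A :: "(nat \<Rightarrow>\<^sub>0 nat) set"
    using that by (induction A) (auto simp: \<phi>_0 \<phi>_add)
  have expand: "p = (\<Sum>m\<in>Poly_Mapping.keys p. Poly_Mapping.single m (Poly_Mapping.lookup p m))"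
    for p :: "'k mpoly"
    by (rule poly_mapping_eqI)
      (auto simp: lookup_sum lookup_single when_def in_keys_iff)
  have \<phi>_mult: "\<phi> (p * q) = \<phi> p * \<phi> q" for p q
  proof -
    have "\<phi> (p * q) = \<phi> ((\<Sum>m\<in>Poly_Mapping.keys p. Poly_Mapping.single m (Poly_Mapping.lookup p m))
        * (\<Sum>m\<in>Poly_Mapping.keys q. Poly_Mapping.single m (Poly_Mapping.lookup q m)))"
      by (simp only: expand[symmetric])
    also have "\<dots> = \<phi> p * \<phi> q"
      by (simp add: sum_product \<phi>_setsum \<phi>_single mult_single D_add \<phi>_def[of p] \<phi>_def[of q])
    finally show ?thesis .
  qed
  have \<phi>_1: "\<phi> 1 = 1"
    using \<phi>_single[of 0 1] by (simp add: D_0)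
  have \<phi>_closed: "\<phi> p \<in> carrier (mpoly_ring (n - 1))" if "p \<in> carrier (mpoly_ring n)" for p
  proof -
    have "Poly_Mapping.keys (\<phi> p) \<subseteq> (\<Union>m\<in>Poly_Mapping.keys p.
        Poly_Mapping.keys (Poly_Mapping.single (D m) (Poly_Mapping.lookup p m)))"
      unfolding \<phi>_def by (rule Poly_Mapping.keys_sum)
    also have "\<dots> \<subseteq> exponents (n - 1)"
      using that by (auto simp: mpoly_ring_def intro!: D_exponents[simplified] split: if_splits)
    finally show ?thesis by (simp add: mpoly_ring_def)
  qed
  have "\<phi> \<in> ring_hom (mpoly_ring n) (mpoly_ring (n - 1))"
    by (rule ring_hom_memI, rule \<phi>_closed)
      (auto simp: mpoly_ring_def \<phi>_mult \<phi>_add \<phi>_1)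
  then have "\<phi> \<in> algebra_hom n (n - 1)"
    by (simp add: algebra_hom_def mconst_def \<phi>_single D_0)
  moreover have "\<phi> (mvar i) = (if i = n then 1 else mvar i)" for i
    by (simp only: mvar_def monomial_def \<phi>_single D_mvar) simp
  ultimately show ?thesis
    using assms by (intro exI[of _ \<phi>]) auto
qed

end

theory Submission
  imports Defs
begin

text \<open>
  A graded isomorphism \<open>F/G \<cong> (S/P)(-a)\<close> amounts to a monomial \<open>x\<^sup>m\<close> of degree \<open>a\<close> with
  \<open>F = G + S x\<^sup>m\<close> and \<open>(G : x\<^sup>m) = P\<close>: take \<open>x\<^sup>m\<close> to be a scalar multiple of a homogeneous preimage
  of \<open>1\<close>. Applying \<open>\<phi>\<close> gives \<open>\<phi>(F) = \<phi>(G) + T \<phi>(x\<^sup>m)\<close>. If \<open>x\<^sub>n \<in> P\<close>, then \<open>x\<^sub>n x\<^sup>m \<in> G\<close>, so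
  \<open>\<phi>(x\<^sup>m) \<in> \<phi>(G)\<close> and the quotient vanishes. If \<open>x\<^sub>n \<notin> P\<close>, then \<open>(\<phi>(G) : \<phi>(x\<^sup>m)) = P \<inter> T\<close>: a monomial
  \<open>x\<^sup>u\<close> of \<open>T\<close> with \<open>x\<^sup>u \<phi>(x\<^sup>m) \<in> \<phi>(G)\<close> satisfies \<open>x\<^sub>n\<^sup>k x\<^sup>u x\<^sup>m \<in> G\<close> for some \<open>k\<close>, so \<open>x\<^sub>n\<^sup>k x\<^sup>u \<in> P\<close>, and
  \<open>x\<^sup>u \<in> P\<close> since \<open>P\<close> is prime.
\<close>

section \<open>Ideals of polynomial rings\<close>

lemma mpoly_ring_simps [simp]:
  "p \<in> carrier (mpoly_ring n) \<longleftrightarrow> Poly_Mapping.keys p \<subseteq> exponents n"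
  "(\<otimes>\<^bsub>mpoly_ring n\<^esub>) = (*)" "(\<oplus>\<^bsub>mpoly_ring n\<^esub>) = (+)"
  "\<one>\<^bsub>mpoly_ring n\<^esub> = 1" "\<zero>\<^bsub>mpoly_ring n\<^esub> = 0"
  by (auto simp: mpoly_ring_def)

lemma zero_in_exponents [simp]: "0 \<in> exponents n"
  by (simp add: exponents_def)

lemma single_in_mpoly_ring [simp]: "m \<in> exponents n \<Longrightarrow> Poly_Mapping.single m c \<in> carrier (mpoly_ring n)"
  by simp

lemma monomial_in_mpoly_ring: "m \<in> exponents n \<Longrightarrow> monomial m \<in> carrier (mpoly_ring n)"
  by (simp add: monomial_def)

lemma mconst_in_mpoly_ring: "mconst c \<in> carrier (mpoly_ring n)"
  by (simp add: mconst_def)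

lemma keys_monomial [simp]: "Poly_Mapping.keys (monomial m :: 'k::field mpoly) = {m}"
  by (simp add: monomial_def)

lemma monomial_0: "monomial 0 = 1"
  by (simp add: monomial_def)

lemma monomial_add: "monomial (u + v) = monomial u * monomial v"
  by (simp add: monomial_def mult_single)

lemma mconst_mult_single: "mconst c * Poly_Mapping.single m d = Poly_Mapping.single m (c * d)"
  by (simp add: mconst_def mult_single)

lemma mconst_mult_monomial: "mconst c * monomial m = Poly_Mapping.single m c"
  by (simp add: monomial_def mconst_mult_single)

lemma mconst_inverse: "c \<noteq> 0 \<Longrightarrow> mconst (inverse c) * (mconst c * p) = p"
  by (simp add: mconst_def mult_single flip: mult.assoc)

lemma uminus_conv_mconst: "- p = mconst (- 1) * p" for p :: "'k::field mpoly"
  by (simp add: mconst_def single_uminus)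

lemma mpoly_expand:
  "p = (\<Sum>m\<in>Poly_Mapping.keys p. Poly_Mapping.single m (Poly_Mapping.lookup p m))"
  by (rule poly_mapping_eqI) (auto simp: lookup_sum lookup_single when_def in_keys_iff)

text \<open>Multiplication by \<open>x^w\<close> shifts exponents injectively, so no terms collide.
  This later guarantees that every exponent of a factor reappears, shifted, in the product.\<close>

lemma lookup_mult_monomial:
  fixes p :: "'k::field mpoly"
  shows "Poly_Mapping.lookup (p * monomial w) (u + w) = Poly_Mapping.lookup p u"
proof -
  have "p * monomial w
      = (\<Sum>m\<in>Poly_Mapping.keys p. Poly_Mapping.single m (Poly_Mapping.lookup p m)) * monomial w"
    by (simp flip: mpoly_expand)
  also have "\<dots> = (\<Sum>m\<in>Poly_Mapping.keys p. Poly_Mapping.single (m + w) (Poly_Mapping.lookup p m))"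
    by (simp add: sum_distrib_right monomial_def mult_single)
  finally show ?thesis
    by (simp add: lookup_sum lookup_single when_def in_keys_iff)
qed

lemma mpoly_nonzero_key: "p \<noteq> 0 \<Longrightarrow> \<exists>m. m \<in> Poly_Mapping.keys p"
  using poly_mapping_eqI[of p 0] by (auto simp: in_keys_iff)

section \<open>Ideals and monomial ideals in terms of membership\<close>

lemma mpoly_ring_closed:
  fixes p q :: "'k::field mpoly"
  assumes "p \<in> carrier (mpoly_ring n)" "q \<in> carrier (mpoly_ring n)"
  shows "p + q \<in> carrier (mpoly_ring n)" "p - q \<in> carrier (mpoly_ring n)"
    "p * q \<in> carrier (mpoly_ring n)"
proof -
  show "p + q \<in> carrier (mpoly_ring n)"
    using assms Poly_Mapping.keys_add[of p q] by auto
  show "p - q \<in> carrier (mpoly_ring n)"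
    using assms keys_diff[of p q] by auto
  show "p * q \<in> carrier (mpoly_ring n)"
    using cring.cring_simprules(5)[OF cring_mpoly_ring assms] by simp
qed

text \<open>Closure under negation comes from the multiplication rule, because \<open>- p\<close> is
  \<open>p\<close> times the constant \<open>- 1\<close>.\<close>

lemma ideal_mpoly_ringI:
  assumes "N \<subseteq> carrier (mpoly_ring n)" "0 \<in> N" "\<And>p q. p \<in> N \<Longrightarrow> q \<in> N \<Longrightarrow> p + q \<in> N"
    and mult: "\<And>r p. r \<in> carrier (mpoly_ring n) \<Longrightarrow> p \<in> N \<Longrightarrow> r * p \<in> N"
  shows "ideal N (mpoly_ring n :: 'k::field mpoly ring)"
proof (rule idealI)
  interpret R: cring "mpoly_ring n :: 'k mpoly ring" by (rule cring_mpoly_ring)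
  show "ring (mpoly_ring n :: 'k mpoly ring)" by (rule R.ring_axioms)
  show "subgroup N (add_monoid (mpoly_ring n))"
  proof (rule R.add.subgroupI)
    fix p assume p: "p \<in> N"
    then have "- p \<in> N"
      using mult[OF mconst_in_mpoly_ring p, of "- 1"] by (simp flip: uminus_conv_mconst)
    moreover have "\<ominus>\<^bsub>mpoly_ring n\<^esub> p = - p"
      by (rule R.minus_equality) (use p assms(1) in \<open>auto simp: subset_iff\<close>)
    ultimately show "\<ominus>\<^bsub>mpoly_ring n\<^esub> p \<in> N" by simp
  qed (use assms in auto)
next
  fix p r :: "'k mpoly" assume pr: "p \<in> N" "r \<in> carrier (mpoly_ring n)"
  then show "r \<otimes>\<^bsub>mpoly_ring n\<^esub> p \<in> N" using mult by simp
  show "p \<otimes>\<^bsub>mpoly_ring n\<^esub> r \<in> N" using mult[OF pr(2,1)] by (simp add: mult.commute)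
qed

lemma ideal_mpoly_ringD:
  assumes "ideal N (mpoly_ring n :: 'k::field mpoly ring)"
  shows "N \<subseteq> carrier (mpoly_ring n)" "0 \<in> N" "\<And>p q. p \<in> N \<Longrightarrow> q \<in> N \<Longrightarrow> p + q \<in> N"
    "\<And>r p. r \<in> carrier (mpoly_ring n) \<Longrightarrow> p \<in> N \<Longrightarrow> r * p \<in> N"
    "\<And>p. p \<in> N \<Longrightarrow> - p \<in> N"
    "\<And>p q. p \<in> N \<Longrightarrow> q \<in> N \<Longrightarrow> p - q \<in> N"
proof -
  interpret ideal N "mpoly_ring n :: 'k mpoly ring" by (rule assms)
  show "N \<subseteq> carrier (mpoly_ring n)" by (rule a_subset)
  show "0 \<in> N" using additive_subgroup.zero_closed[OF additive_subgroup_axioms] by simp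
  show add: "p + q \<in> N" if "p \<in> N" "q \<in> N" for p q
    using additive_subgroup.a_closed[OF additive_subgroup_axioms that] by simp
  show mult: "r * p \<in> N" if "r \<in> carrier (mpoly_ring n)" "p \<in> N" for r p
    using I_l_closed[OF that(2,1)] by simp
  show uminus: "- p \<in> N" if "p \<in> N" for p
    unfolding uminus_conv_mconst[of p] by (rule mult[OF mconst_in_mpoly_ring that])
  show "p - q \<in> N" if "p \<in> N" "q \<in> N" for p q using add[OF that(1) uminus[OF that(2)]] by simp
qed

lemma ideal_mpoly_ring_sum:
  assumes "ideal N (mpoly_ring n)" "\<And>x. x \<in> A \<Longrightarrow> g x \<in> N"
  shows "sum g A \<in> N"
  using assms(2)
  by (induction A rule: infinite_finite_induct) (auto simp: ideal_mpoly_ringD[OF assms(1)])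

lemma ideal_mconst_mult_iff:
  assumes "ideal N (mpoly_ring n)" "c \<noteq> 0"
  shows "mconst c * p \<in> N \<longleftrightarrow> p \<in> N"
proof
  assume "mconst c * p \<in> N"
  then show "p \<in> N"
    using ideal_mpoly_ringD(4)[OF assms(1) mconst_in_mpoly_ring, of "mconst c * p" "inverse c"]
    by (simp add: mconst_inverse[OF assms(2)])
qed (rule ideal_mpoly_ringD(4)[OF assms(1) mconst_in_mpoly_ring])

lemma ideal_single_iff:
  assumes "ideal N (mpoly_ring n)" "c \<noteq> 0"
  shows "Poly_Mapping.single m c \<in> N \<longleftrightarrow> monomial m \<in> N"
  using ideal_mconst_mult_iff[OF assms, of "monomial m"] by (simp add: mconst_mult_monomial)

text \<open>A polynomial is a linear combination of its monomials. The converse,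
  \<open>monomial_ideal_keys\<close>, is where monomiality of the ideal enters.\<close>

lemma ideal_of_monomials:
  assumes "ideal N (mpoly_ring n)" "\<And>m. m \<in> Poly_Mapping.keys p \<Longrightarrow> monomial m \<in> N"
  shows "p \<in> N"
proof -
  have "(\<Sum>m\<in>Poly_Mapping.keys p. Poly_Mapping.single m (Poly_Mapping.lookup p m)) \<in> N"
  proof (rule ideal_mpoly_ring_sum[OF assms(1)])
    fix m assume m: "m \<in> Poly_Mapping.keys p"
    then have "Poly_Mapping.lookup p m \<noteq> 0" by (simp add: in_keys_iff)
    then show "Poly_Mapping.single m (Poly_Mapping.lookup p m) \<in> N"
      using ideal_single_iff[OF assms(1)] assms(2)[OF m] by blast
  qed
  then show ?thesis by (simp flip: mpoly_expand)
qed

lemma one_notin_primeideal: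
  assumes "primeideal P (mpoly_ring n)"
  shows "1 \<notin> P"
proof
  interpret primeideal P "mpoly_ring n" by (rule assms)
  assume "1 \<in> P"
  then have "P = carrier (mpoly_ring n)" by (intro one_imp_carrier) simp
  then show False using I_notcarr by blast
qed

lemma genideal_mpoly_ring:
  assumes "A \<subseteq> carrier (mpoly_ring n)"
  shows "ideal (genideal (mpoly_ring n) A) (mpoly_ring n)"
    "A \<subseteq> genideal (mpoly_ring n) A"
    "\<And>N. ideal N (mpoly_ring n) \<Longrightarrow> A \<subseteq> N \<Longrightarrow> genideal (mpoly_ring n) A \<subseteq> N"
proof -
  interpret cring "mpoly_ring n" by (rule cring_mpoly_ring)
  show "ideal (genideal (mpoly_ring n) A) (mpoly_ring n)" by (rule genideal_ideal[OF assms])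
  show "A \<subseteq> genideal (mpoly_ring n) A" by (rule genideal_self[OF assms])
  show "genideal (mpoly_ring n) A \<subseteq> N" if "ideal N (mpoly_ring n)" "A \<subseteq> N" for N
    by (rule genideal_minimal[OF that])
qed

lemma ideal_of_monomial_ideal:
  assumes "monomial_ideal n N"
  shows "ideal N (mpoly_ring n)"
proof -
  obtain A where A: "A \<subseteq> monomial ` exponents n" "N = genideal (mpoly_ring n) A"
    using assms unfolding monomial_ideal_def by blast
  have "A \<subseteq> carrier (mpoly_ring n)" using A(1) monomial_in_mpoly_ring by blast
  then show ?thesis unfolding A(2) by (rule genideal_mpoly_ring(1))
qed

text \<open>The polynomials all of whose monomials lie in \<open>N\<close> form an ideal
  \<open>?J\<close> that contains the monomial generators of \<open>N\<close>, hence contains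
  \<open>N\<close>.\<close>

lemma monomial_ideal_keys:
  fixes N :: "'k::field mpoly set"
  assumes "monomial_ideal n N" "p \<in> N" "m \<in> Poly_Mapping.keys p"
  shows "monomial m \<in> N"
proof -
  obtain A where A: "A \<subseteq> monomial ` exponents n" "N = genideal (mpoly_ring n) A"
    using assms(1) unfolding monomial_ideal_def by blast
  have A_carrier: "A \<subseteq> carrier (mpoly_ring n)" using A(1) monomial_in_mpoly_ring by blast
  note N = ideal_mpoly_ringD[OF ideal_of_monomial_ideal[OF assms(1)]]
  let ?J = "{p \<in> carrier (mpoly_ring n :: 'k mpoly ring). \<forall>m\<in>Poly_Mapping.keys p. monomial m \<in> N}"
  have "ideal ?J (mpoly_ring n)"
  proof (rule ideal_mpoly_ringI)
    fix p q :: "'k mpoly" assume "p \<in> ?J" "q \<in> ?J"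
    then show "p + q \<in> ?J"
      using mpoly_ring_closed(1)[of p n q] Poly_Mapping.keys_add[of p q] by blast
  next
    fix r p :: "'k mpoly" assume rp: "r \<in> carrier (mpoly_ring n)" "p \<in> ?J"
    \<comment> \<open>Each exponent of \<open>r * p\<close> is a sum \<open>v + w\<close> with
      \<open>w\<close> an exponent of \<open>p\<close>, so its monomial is a multiple of
      \<open>monomial w\<close>, which lies in \<open>N\<close>.\<close>
    have "(monomial u :: 'k mpoly) \<in> N" if u: "u \<in> Poly_Mapping.keys (r * p)" for u
    proof -
      obtain v w where vw: "u = v + w" "v \<in> Poly_Mapping.keys r" "w \<in> Poly_Mapping.keys p"
        using u keys_mult[of r p] by blast
      then show ?thesis
        unfolding vw(1) monomial_add using rp by (intro N(4) monomial_in_mpoly_ring) auto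
    qed
    then show "r * p \<in> ?J" using mpoly_ring_closed(3)[of r n p] rp by blast
  next
    show "?J \<subseteq> carrier (mpoly_ring n)" by blast
    show "0 \<in> ?J" by simp
  qed
  moreover have "A \<subseteq> ?J"
  proof
    fix p assume p: "p \<in> A"
    then obtain m where "p = monomial m" using A(1) by blast
    then show "p \<in> ?J" using p genideal_mpoly_ring(2)[OF A_carrier] A_carrier A(2) by auto
  qed
  ultimately have "N \<subseteq> ?J" unfolding A(2) by (rule genideal_mpoly_ring(3)[OF A_carrier])
  then show ?thesis using assms(2,3) by blast
qed

section \<open>Quotients by ideals\<close>

text \<open>Uses addition only and does not mention the ambient module, so cosets in
  \<open>ideal_module M\<close> have the same form for every \<open>M\<close>.\<close>

definition coset :: "'a::ab_group_add set \<Rightarrow> 'a \<Rightarrow> 'a set" where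
  "coset N x = (\<lambda>h. h + x) ` N"

lemma in_coset_iff: "y \<in> coset N x \<longleftrightarrow> y - x \<in> N"
  by (auto simp: coset_def intro!: image_eqI[of _ _ "y - x"])

lemma coset_ideal_module: "N +>\<^bsub>ideal_module M\<^esub> x = coset N x"
  by (auto simp: coset_def a_r_coset_def' ideal_module_def)

lemma quotient_module_simps:
  "carrier (quotient_module (ideal_module M) N) = coset N ` M"
  "component (quotient_module (ideal_module M) N) d = coset N `
    {p \<in> M. \<forall>m \<in> Poly_Mapping.keys p. Poly_Mapping.map int m = d}"
  by (auto simp: quotient_module_def A_RCOSETS_def' coset_ideal_module)
    (auto simp: ideal_module_def)

lemma cyclic_module_simps:
  "carrier (cyclic_module n P a) = coset P ` carrier (mpoly_ring n)"
  "component (cyclic_module n P a) d = coset P `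
    {p \<in> carrier (mpoly_ring n). \<forall>m \<in> Poly_Mapping.keys p. Poly_Mapping.map int m = d - a}"
  "add (cyclic_module n P a) = add (quotient_module (ideal_module (carrier (mpoly_ring n))) P)"
  "smult (cyclic_module n P a) = smult (quotient_module (ideal_module (carrier (mpoly_ring n))) P)"
  by (simp_all add: twist_def quotient_module_simps)

context
  fixes N :: "'k::field mpoly set" and n :: nat
  assumes N: "ideal N (mpoly_ring n)"
begin

lemma coset_eq_iff: "coset N x = coset N y \<longleftrightarrow> x - y \<in> N"
proof
  assume "coset N x = coset N y"
  moreover have "x \<in> coset N x" using ideal_mpoly_ringD(2)[OF N] by (simp add: in_coset_iff)
  ultimately show "x - y \<in> N" by (simp add: in_coset_iff)
next
  assume xy: "x - y \<in> N"
  have "z - x \<in> N \<longleftrightarrow> z - y \<in> N" for z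
    using ideal_mpoly_ringD(3)[OF N _ xy, of "z - x"] ideal_mpoly_ringD(6)[OF N _ xy, of "z - y"] by auto
  then show "coset N x = coset N y" by (auto simp: in_coset_iff)
qed

lemma coset_add:
  "coset N x \<oplus>\<^bsub>quotient_module (ideal_module M) N\<^esub> coset N y = coset N (x + y)"
proof -
  have "coset N x \<oplus>\<^bsub>quotient_module (ideal_module M) N\<^esub> coset N y
      = (\<Union>u\<in>coset N x. \<Union>v\<in>coset N y. {u + v})"
    by (auto simp: quotient_module_def set_add_def set_mult_def ideal_module_def)
  also have "\<dots> = coset N (x + y)"
  proof (intro equalityI subsetI)
    fix z assume "z \<in> (\<Union>u\<in>coset N x. \<Union>v\<in>coset N y. {u + v})"
    then obtain u v where uv: "u - x \<in> N" "v - y \<in> N" "z = u + v"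
      by (auto simp: in_coset_iff)
    then show "z \<in> coset N (x + y)"
      using ideal_mpoly_ringD(3)[OF N uv(1,2)] by (simp add: in_coset_iff algebra_simps)
  next
    fix z assume "z \<in> coset N (x + y)"
    then have "z - y \<in> coset N x" "y \<in> coset N y" "z = (z - y) + y"
      using ideal_mpoly_ringD(2)[OF N] by (auto simp: in_coset_iff algebra_simps)
    then show "z \<in> (\<Union>u\<in>coset N x. \<Union>v\<in>coset N y. {u + v})" by blast
  qed
  finally show ?thesis .
qed

text \<open>The union in the definition of \<open>smult\<close> runs over all representatives of the
  class. They all give the same coset because \<open>N\<close> is an ideal, and there is at least
  one, namely \<open>x\<close>.\<close>

lemma coset_smult:
  assumes r: "r \<in> carrier (mpoly_ring n)"
  shows "r \<odot>\<^bsub>quotient_module (ideal_module M) N\<^esub> coset N x = coset N (r * x)"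
proof -
  have "r \<odot>\<^bsub>quotient_module (ideal_module M) N\<^esub> coset N x = (\<Union>y\<in>coset N x. coset N (r * y))"
    unfolding quotient_module_def coset_ideal_module by (simp add: ideal_module_def)
  also have "\<dots> = (\<Union>y\<in>coset N x. coset N (r * x))"
  proof (rule SUP_cong[OF refl])
    fix y assume "y \<in> coset N x"
    then show "coset N (r * y) = coset N (r * x)"
      using ideal_mpoly_ringD(4)[OF N r, of "y - x"] unfolding coset_eq_iff
      by (simp add: in_coset_iff algebra_simps)
  qed
  also have "\<dots> = coset N (r * x)"
    using ideal_mpoly_ringD(2)[OF N] in_coset_iff[of x N x] by auto
  finally show ?thesis .
qed

end

text \<open>For monomial ideals \<open>G \<subseteq> F\<close> this says exactly that \<open>F/G \<cong> (S/P)(-m)\<close>.\<close>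

definition cyclic_step ::
    "nat \<Rightarrow> 'k::field mpoly set \<Rightarrow> 'k mpoly set \<Rightarrow> 'k mpoly set \<Rightarrow> (nat \<Rightarrow>\<^sub>0 nat) \<Rightarrow> bool" where
  "cyclic_step n F G P m \<longleftrightarrow> m \<in> exponents n \<and> monomial m \<in> F \<and>
     (\<forall>q\<in>F. \<exists>s\<in>carrier (mpoly_ring n). q - s * monomial m \<in> G) \<and>
     (\<forall>s\<in>carrier (mpoly_ring n). s * monomial m \<in> G \<longleftrightarrow> s \<in> P)"

section \<open>Graded isomorphisms onto twisted cyclic modules\<close>

lemma lookup_map_int: "Poly_Mapping.lookup (Poly_Mapping.map int u) k = int (Poly_Mapping.lookup u k)"
  by (simp add: map.rep_eq when_def)

lemma map_int_inject: "Poly_Mapping.map int u = Poly_Mapping.map int v \<longleftrightarrow> u = v"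
proof
  assume *: "Poly_Mapping.map int u = Poly_Mapping.map int v"
  show "u = v"
  proof (rule poly_mapping_eqI)
    fix k show "Poly_Mapping.lookup u k = Poly_Mapping.lookup v k"
      using arg_cong[OF *, of "\<lambda>w. Poly_Mapping.lookup w k"] by (simp add: lookup_map_int)
  qed
qed simp

lemma map_int_add: "Poly_Mapping.map int (u + v) = Poly_Mapping.map int u + Poly_Mapping.map int v"
  by (rule poly_mapping_eqI) (simp add: lookup_map_int lookup_add)

text \<open>In the fine grading distinct monomials have distinct degrees, so a homogeneous
  polynomial has at most one term.\<close>

lemma homogeneous_eq_single:
  assumes "\<forall>u\<in>Poly_Mapping.keys p. Poly_Mapping.map int u = d" "m \<in> Poly_Mapping.keys p"
  shows "p = Poly_Mapping.single m (Poly_Mapping.lookup p m)"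
proof (rule poly_mapping_eqI)
  fix k
  have "k \<notin> Poly_Mapping.keys p" if "k \<noteq> m"
    using assms that map_int_inject[of k m] by metis
  then show "Poly_Mapping.lookup p k
      = Poly_Mapping.lookup (Poly_Mapping.single m (Poly_Mapping.lookup p m)) k"
    by (simp add: lookup_single when_def in_keys_iff)
qed

lemma graded_isoE:
  assumes "graded_iso n M N"
  obtains f where "bij_betw f (carrier M) (carrier N)"
    "\<And>r x. r \<in> carrier (mpoly_ring n) \<Longrightarrow> x \<in> carrier M \<Longrightarrow> f (r \<odot>\<^bsub>M\<^esub> x) = r \<odot>\<^bsub>N\<^esub> f x"
    "\<And>d. d \<in> degrees n \<Longrightarrow> f ` component M d = component N d"
proof -
  obtain f where f: "bij_betw f (carrier M) (carrier N)"
    "\<forall>r\<in>carrier (mpoly_ring n). \<forall>x\<in>carrier M. f (r \<odot>\<^bsub>M\<^esub> x) = r \<odot>\<^bsub>N\<^esub> f x"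
    "\<forall>d\<in>degrees n. f ` component M d = component N d"
    using assms unfolding graded_iso_def by (elim exE conjE)
  show ?thesis by (rule that[OF f(1) f(2,3)[rule_format]])
qed

text \<open>Surjectivity of the isomorphism shows that the preimage \<open>p\<close> of the class of
  1 generates \<open>F\<close> modulo \<open>G\<close>; injectivity shows that its annihilator
  modulo \<open>G\<close> is \<open>P\<close>. In particular \<open>a\<close> turns out to be the
  degree of a monomial.\<close>

lemma cyclic_step_of_graded_iso:
  fixes F G P :: "'k::field mpoly set"
  assumes F: "ideal F (mpoly_ring n)" and G: "ideal G (mpoly_ring n)"
    and P: "ideal P (mpoly_ring n)" "1 \<notin> P" and a: "a \<in> degrees n"
    and iso: "graded_iso n (quotient_module (ideal_module F) G) (cyclic_module n P a)"
  obtains m where "Poly_Mapping.map int m = a" "cyclic_step n F G P m"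
proof -
  let ?R = "carrier (mpoly_ring n) :: 'k mpoly set"
  let ?G = "coset G" and ?P = "coset P"
  let ?Q = "quotient_module (ideal_module F) G"
  let ?C = "cyclic_module n P a"
  obtain f where bij: "bij_betw f (carrier ?Q) (carrier ?C)"
    and smult: "\<And>r x. r \<in> ?R \<Longrightarrow> x \<in> carrier ?Q \<Longrightarrow> f (r \<odot>\<^bsub>?Q\<^esub> x) = r \<odot>\<^bsub>?C\<^esub> f x"
    and comp: "\<And>d. d \<in> degrees n \<Longrightarrow> f ` component ?Q d = component ?C d"
    by (rule graded_isoE[OF iso], rule that)
  have one: "1 \<in> ?R" by simp
  \<comment> \<open>The only exponent of 1 is 0, and degree 0 of \<open>S/P\<close> becomes degree
    \<open>a\<close> after the twist.\<close>
  have "?P 1 \<in> component ?C a"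
    unfolding cyclic_module_simps by (rule imageI) (simp add: map_eq_zero_iff)
  then obtain p where p: "p \<in> F" "\<forall>u\<in>Poly_Mapping.keys p. Poly_Mapping.map int u = a"
    and fp: "f (?G p) = ?P 1"
    unfolding comp[OF a, symmetric] quotient_module_simps by (elim imageE) auto
  have mem: "?G q \<in> carrier ?Q" if "q \<in> F" for q
    unfolding quotient_module_simps using that by (rule imageI)
  have Rp: "r * p \<in> F" if "r \<in> ?R" for r by (rule ideal_mpoly_ringD(4)[OF F that p(1)])
  have f: "f (?G (r * p)) = ?P r" if r: "r \<in> ?R" for r
    using smult[OF r mem[OF p(1)]] unfolding fp cyclic_module_simps
      coset_smult[OF G r] coset_smult[OF P(1) r] by simp
  have eq_iff: "?G q = ?G q' \<longleftrightarrow> f (?G q) = f (?G q')" if "q \<in> F" "q' \<in> F" for q q'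
    using inj_on_eq_iff[OF bij_betw_imp_inj_on[OF bij] mem mem] that by simp
  have zero: "0 \<in> ?R" by simp
  \<comment> \<open>Compare the classes of \<open>r * p\<close> and \<open>0 * p\<close>, whose
    images under \<open>f\<close> are the classes of \<open>r\<close> and 0.\<close>
  have colon: "r * p \<in> G \<longleftrightarrow> r \<in> P" if r: "r \<in> ?R" for r
    using eq_iff[OF Rp[OF r] Rp[OF zero]]
    unfolding f[OF r] f[OF zero] coset_eq_iff[OF G] coset_eq_iff[OF P(1)] by simp
  have "p \<noteq> 0" using colon[OF one] P(2) ideal_mpoly_ringD(2)[OF G] by auto
  then obtain m where m: "m \<in> Poly_Mapping.keys p" using mpoly_nonzero_key by blast
  define c where "c = Poly_Mapping.lookup p m"
  have c: "c \<noteq> 0" using m by (simp add: c_def in_keys_iff)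
  have p_eq: "p = mconst c * monomial m"
    unfolding c_def mconst_mult_monomial by (rule homogeneous_eq_single[OF p(2) m])
  have "cyclic_step n F G P m"
    unfolding cyclic_step_def
  proof (intro conjI ballI)
    show "m \<in> exponents n" using ideal_mpoly_ringD(1)[OF F] p(1) m by (auto simp: subset_iff)
    show "monomial m \<in> F" using p(1) unfolding p_eq ideal_mconst_mult_iff[OF F c] .
  next
    fix q assume q: "q \<in> F"
    then have "f (?G q) \<in> carrier ?C" using bij_betwE[OF bij] mem by blast
    then obtain s where s: "s \<in> ?R" "f (?G q) = ?P s" unfolding cyclic_module_simps by blast
    then have "?G q = ?G (s * p)" using eq_iff[OF q Rp[OF s(1)]] f[OF s(1)] by simp
    \<comment> \<open>The scalar \<open>c\<close> relating \<open>p\<close> to its monomial is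
      absorbed into the coefficient.\<close>
    then have "q - (s * mconst c) * monomial m \<in> G"
      unfolding coset_eq_iff[OF G] by (simp add: p_eq mult.assoc)
    then show "\<exists>s\<in>?R. q - s * monomial m \<in> G"
      using mpoly_ring_closed(3)[OF s(1) mconst_in_mpoly_ring] by blast
  next
    fix s assume s: "s \<in> ?R"
    have "s * monomial m \<in> G \<longleftrightarrow> mconst c * (s * monomial m) \<in> G"
      by (rule ideal_mconst_mult_iff[OF G c, symmetric])
    also have "mconst c * (s * monomial m) = s * p" by (simp add: p_eq mult_ac)
    finally show "s * monomial m \<in> G \<longleftrightarrow> s \<in> P" using colon[OF s] by simp
  qed
  moreover have "Poly_Mapping.map int m = a" using p(2) m by blast
  ultimately show ?thesis using that by blast
qed

text \<open>The isomorphism sends the class of \<open>s * monomial m\<close> to the class of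
  \<open>s\<close>. The colon condition makes it well defined and injective, and the generation
  condition makes it defined on all of \<open>F/G\<close>.\<close>

lemma graded_iso_of_cyclic_step:
  fixes F G P :: "'k::field mpoly set"
  assumes F: "ideal F (mpoly_ring n)" and G: "monomial_ideal n G"
    and GF: "G \<subseteq> F" and P: "ideal P (mpoly_ring n)" and step: "cyclic_step n F G P m"
  shows "graded_iso n (quotient_module (ideal_module F) G) (cyclic_module n P (Poly_Mapping.map int m))"
proof -
  let ?R = "carrier (mpoly_ring n) :: 'k mpoly set"
  let ?G = "coset G" and ?P = "coset P"
  let ?Q = "quotient_module (ideal_module F) G"
  let ?C = "cyclic_module n P (Poly_Mapping.map int m)"
  define c :: "'k mpoly" where "c = monomial m"
  note G' = ideal_of_monomial_ideal[OF G]
  have m: "m \<in> exponents n" and c: "c \<in> F"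
    and gen: "\<And>q. q \<in> F \<Longrightarrow> \<exists>s\<in>?R. q - s * c \<in> G"
    and colon: "\<And>s. s \<in> ?R \<Longrightarrow> s * c \<in> G \<longleftrightarrow> s \<in> P"
    using step unfolding cyclic_step_def c_def by blast+
  \<comment> \<open>No representative is chosen: \<open>f X\<close> is the set of all
    \<open>s\<close> with \<open>s * c\<close> in the class \<open>X\<close>, and this set is itself
    a coset of \<open>P\<close>.\<close>
  define f where "f X = {s \<in> ?R. ?G (s * c) = X}" for X
  have f: "f (?G (s * c)) = ?P s" if s: "s \<in> ?R" for s
  proof -
    have "t \<in> f (?G (s * c)) \<longleftrightarrow> t \<in> ?P s" for t
    proof -
      have "t \<in> ?P s \<longleftrightarrow> t - s \<in> P" by (simp add: in_coset_iff)
      also have "\<dots> \<longleftrightarrow> t \<in> ?R \<and> t - s \<in> P"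
        using mpoly_ring_closed(1)[of "t - s" n s] s ideal_mpoly_ringD(1)[OF P] by (auto simp del: mpoly_ring_simps)
      also have "\<dots> \<longleftrightarrow> t \<in> ?R \<and> (t - s) * c \<in> G"
        using colon[of "t - s"] mpoly_ring_closed(2)[OF _ s, of t] by blast
      also have "\<dots> \<longleftrightarrow> t \<in> f (?G (s * c))"
        by (simp only: f_def mem_Collect_eq coset_eq_iff[OF G'] left_diff_distrib)
      finally show ?thesis by simp
    qed
    then show ?thesis by blast
  qed
  have coset_repr: "\<exists>s\<in>?R. ?G q = ?G (s * c)" if "q \<in> F" for q
    using gen[OF that] unfolding coset_eq_iff[OF G'] .
  have Rc: "s * c \<in> F" if "s \<in> ?R" for s by (rule ideal_mpoly_ringD(4)[OF F that c])
  have carrier_Q: "carrier ?Q = (\<lambda>s. ?G (s * c)) ` ?R"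
    unfolding quotient_module_simps using coset_repr Rc by (auto simp: image_iff)
  have inj: "?G (s * c) = ?G (t * c) \<longleftrightarrow> ?P s = ?P t" if "s \<in> ?R" "t \<in> ?R" for s t
    unfolding coset_eq_iff[OF G'] coset_eq_iff[OF P]
    using colon[OF mpoly_ring_closed(2)[OF that]] by (simp add: left_diff_distrib)
  have "bij_betw f (carrier ?Q) (carrier ?C)"
    unfolding bij_betw_def
  proof
    show "inj_on f (carrier ?Q)"
      unfolding carrier_Q
    proof (intro inj_onI, elim imageE)
      fix X Y s t assume *: "f X = f Y" "X = ?G (s * c)" "s \<in> ?R" "Y = ?G (t * c)" "t \<in> ?R"
      then show "X = Y" using inj[OF *(3,5)] by (simp only: f)
    qed
    show "f ` carrier ?Q = carrier ?C"
      unfolding carrier_Q cyclic_module_simps image_image using f by (rule image_cong[OF refl])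
  qed
  moreover have "f (x \<oplus>\<^bsub>?Q\<^esub> y) = f x \<oplus>\<^bsub>?C\<^esub> f y" if xy: "x \<in> carrier ?Q" "y \<in> carrier ?Q" for x y
  proof -
    obtain s t where st: "s \<in> ?R" "x = ?G (s * c)" "t \<in> ?R" "y = ?G (t * c)"
      using xy unfolding carrier_Q by blast
    show ?thesis
      unfolding st(2,4) f[OF st(1)] f[OF st(3)] cyclic_module_simps coset_add[OF G'] coset_add[OF P]
      using f[OF mpoly_ring_closed(1)[OF st(1,3)]] by (simp only: distrib_right)
  qed
  moreover have "f (r \<odot>\<^bsub>?Q\<^esub> x) = r \<odot>\<^bsub>?C\<^esub> f x" if r: "r \<in> ?R" and x: "x \<in> carrier ?Q" for r x
  proof -
    obtain s where s: "s \<in> ?R" "x = ?G (s * c)"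
      using x unfolding carrier_Q by blast
    show ?thesis
      unfolding s(2) f[OF s(1)] cyclic_module_simps coset_smult[OF G' r] coset_smult[OF P r]
      using f[OF mpoly_ring_closed(3)[OF r s(1)]] by (simp only: mult.assoc)
  qed
  moreover have "f ` component ?Q d = component ?C d" for d
  proof (intro equalityI subsetI)
    fix Y assume "Y \<in> f ` component ?Q d"
    then obtain q where q: "q \<in> F" "\<forall>u\<in>Poly_Mapping.keys q. Poly_Mapping.map int u = d"
      and Y: "Y = f (?G q)"
      unfolding quotient_module_simps by blast
    \<comment> \<open>The generation condition gives some coefficient \<open>s\<close>, not
      necessarily a homogeneous one. A homogeneous one has to be extracted: 0 if \<open>q\<close>
      lies in \<open>G\<close>, a single term otherwise.\<close>
    have "\<exists>s\<in>?R. (\<forall>u\<in>Poly_Mapping.keys s. Poly_Mapping.map int u = d - Poly_Mapping.map int m)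
        \<and> ?G q = ?G (s * c)"
    proof (cases "q \<in> G")
      case True
      then show ?thesis
        by (intro bexI[of _ 0] conjI) (simp_all only: coset_eq_iff[OF G'], auto)
    next
      case False
      then have "q \<noteq> 0" using ideal_mpoly_ringD(2)[OF G'] by blast
      then obtain u where u: "u \<in> Poly_Mapping.keys q" using mpoly_nonzero_key by blast
      define b where "b = Poly_Mapping.lookup q u"
      have b: "b \<noteq> 0" using u by (simp add: b_def in_keys_iff)
      have q_eq: "q = Poly_Mapping.single u b"
        unfolding b_def by (rule homogeneous_eq_single[OF q(2) u])
      obtain s where s: "s \<in> ?R" "q - s * c \<in> G" using gen[OF q(1)] by blast
      have "monomial u \<notin> G" using False ideal_single_iff[OF G' b] by (simp add: q_eq)
      \<comment> \<open>As \<open>G\<close> is monomial, the term of \<open>q\<close> must be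
        cancelled by a term of \<open>s * c\<close>. Hence \<open>monomial m\<close> divides
        \<open>monomial u\<close>, and \<open>q\<close> is an exact multiple of
        \<open>c\<close>.\<close>
      then have "u \<notin> Poly_Mapping.keys (q - s * c)" using monomial_ideal_keys[OF G s(2)] by blast
      then have "u \<in> Poly_Mapping.keys (s * c)" using u by (auto simp: in_keys_iff lookup_minus)
      then obtain v where v: "v \<in> Poly_Mapping.keys s" "u = v + m"
        using keys_mult[of s c] by (auto simp: c_def)
      have "Poly_Mapping.single v b \<in> ?R" using s(1) v(1) by (auto simp: subset_iff)
      moreover have "q = Poly_Mapping.single v b * c"
        by (simp add: q_eq v(2) c_def monomial_def mult_single)
      moreover have "Poly_Mapping.map int v = d - Poly_Mapping.map int m"
        using q(2) u v(2) by (auto simp: map_int_add)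
      ultimately show ?thesis by (intro bexI[of _ "Poly_Mapping.single v b"]) auto
    qed
    then show "Y \<in> component ?C d"
      unfolding Y cyclic_module_simps using f by auto
  next
    fix Y assume "Y \<in> component ?C d"
    then obtain s where s: "s \<in> ?R" "Y = ?P s"
      "\<forall>u\<in>Poly_Mapping.keys s. Poly_Mapping.map int u = d - Poly_Mapping.map int m"
      unfolding cyclic_module_simps by blast
    have "\<forall>u\<in>Poly_Mapping.keys (s * c). Poly_Mapping.map int u = d"
    proof
      fix u assume "u \<in> Poly_Mapping.keys (s * c)"
      then obtain v where "v \<in> Poly_Mapping.keys s" "u = v + m"
        using keys_mult[of s c] by (auto simp: c_def)
      then show "Poly_Mapping.map int u = d" using s(3) by (simp add: map_int_add)
    qed
    then have "?G (s * c) \<in> component ?Q d"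
      unfolding quotient_module_simps using Rc[OF s(1)] by blast
    then show "Y \<in> f ` component ?Q d" unfolding s(2) f[OF s(1), symmetric] by (rule imageI)
  qed
  ultimately show ?thesis unfolding graded_iso_def by blast
qed

text \<open>The only coset is \<open>N\<close> itself, and it occurs in every component because 0 is
  homogeneous of every degree.\<close>

lemma graded_iso_zero_module:
  fixes N :: "'k::field mpoly set"
  assumes "ideal N (mpoly_ring n)"
  shows "graded_iso k (quotient_module (ideal_module N) N) zero_module"
proof -
  have coset: "coset N x = N" if "x \<in> N" for x
    using coset_eq_iff[OF assms, of x 0] that by (simp add: coset_def[of N 0])
  have zero: "0 \<in> N" by (rule ideal_mpoly_ringD(2)[OF assms])
  have carrier: "carrier (quotient_module (ideal_module N) N) = {N}"
    unfolding quotient_module_simps using coset zero by auto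
  have component: "component (quotient_module (ideal_module N) N) d \<noteq> {}" for d
    unfolding quotient_module_simps using zero by (auto intro: exI[of _ 0])
  define g :: "'k mpoly set \<Rightarrow> unit" where "g X = ()" for X
  have "g ` A = {()}" if "A \<noteq> {}" for A using that by (auto simp: g_def)
  with component have image: "g ` component (quotient_module (ideal_module N) N) d = {()}" for d by blast
  show ?thesis
    unfolding graded_iso_def
  proof (rule exI[of _ g], intro conjI ballI)
    show "bij_betw g (carrier (quotient_module (ideal_module N) N)) (carrier zero_module)"
      unfolding carrier by (simp add: bij_betw_def g_def zero_module_def)
    fix d
    show "g ` component (quotient_module (ideal_module N) N) d = component zero_module d"
      unfolding image by (simp add: zero_module_def)
  qed simp_all
qed

section \<open>The substitution \<open>x\<^sub>n \<mapsto> 1\<close>\<close>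

definition drop_var :: "nat \<Rightarrow> (nat \<Rightarrow>\<^sub>0 nat) \<Rightarrow> (nat \<Rightarrow>\<^sub>0 nat)" where
  "drop_var n m = Poly_Mapping.update n 0 m"

lemma lookup_drop_var: "Poly_Mapping.lookup (drop_var n m) i = (if i = n then 0 else Poly_Mapping.lookup m i)"
  by (simp add: drop_var_def update.rep_eq)

lemma drop_var_add: "drop_var n (u + v) = drop_var n u + drop_var n v"
  by (rule poly_mapping_eqI) (simp add: lookup_drop_var lookup_add)

lemma drop_var_single: "drop_var n (Poly_Mapping.single i k) = (if i = n then 0 else Poly_Mapping.single i k)"
  by (rule poly_mapping_eqI) (auto simp: lookup_drop_var lookup_single when_def)

lemma drop_var_0: "drop_var n 0 = 0"
  by (rule poly_mapping_eqI) (simp add: lookup_drop_var)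

lemma exponents_mono: "m \<in> exponents (n - 1) \<Longrightarrow> m \<in> exponents n"
  unfolding exponents_def by fastforce

lemma mpoly_ring_mono: "p \<in> carrier (mpoly_ring (n - 1)) \<Longrightarrow> p \<in> carrier (mpoly_ring n)"
  using exponents_mono by auto

lemma drop_var_exponents: "m \<in> exponents n \<Longrightarrow> drop_var n m \<in> exponents (n - 1)"
proof -
  assume m: "m \<in> exponents n"
  have "i \<in> {1..n - 1}" if "i \<in> Poly_Mapping.keys (drop_var n m)" for i
  proof -
    have "i \<noteq> n" "i \<in> Poly_Mapping.keys m"
      using that by (auto simp: in_keys_iff lookup_drop_var split: if_splits)
    then show ?thesis using m unfolding exponents_def by fastforce
  qed
  then show ?thesis unfolding exponents_def by blast
qed

lemma lookup_last_exponent: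
  assumes "n \<ge> 1" "m \<in> exponents (n - 1)"
  shows "Poly_Mapping.lookup m n = 0"
proof -
  have "n \<notin> Poly_Mapping.keys m" using assms by (auto simp: exponents_def subset_iff)
  then show ?thesis by (simp add: in_keys_iff)
qed

lemma drop_var_id: "n \<ge> 1 \<Longrightarrow> m \<in> exponents (n - 1) \<Longrightarrow> drop_var n m = m"
  by (rule poly_mapping_eqI) (simp add: lookup_drop_var lookup_last_exponent)

text \<open>This is the source of the shift in the conclusion: if \<open>x^m\<close> has degree
  \<open>a\<close>, setting \<open>x_n\<close> to 1 leaves a monomial whose degree is
  \<open>a\<close> without its last coordinate.\<close>

lemma drop_coord_map_int: "drop_coord n (Poly_Mapping.map int m) = Poly_Mapping.map int (drop_var n m)"
  by (rule poly_mapping_eqI) (simp add: drop_coord_def update.rep_eq lookup_map_int lookup_drop_var)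

lemma mvar_in_mpoly_ring: "i \<in> {1..n} \<Longrightarrow> mvar i \<in> carrier (mpoly_ring n)"
  by (simp add: mvar_def exponents_def)

lemma mvar_eq_monomial: "mvar i = monomial (Poly_Mapping.single i (Suc 0))"
  by (simp add: mvar_def)

section \<open>The substitution on polynomials\<close>

context
  fixes n :: nat and \<phi> :: "'k::field mpoly \<Rightarrow> 'k mpoly"
  assumes n: "n \<ge> 1" and hom: "\<phi> \<in> algebra_hom n (n - 1)"
    and fix_vars: "\<forall>i\<in>{1..n-1}. \<phi> (mvar i) = mvar i"
    and last_var: "\<phi> (mvar n) = 1"
begin

abbreviation (input) S :: "'k mpoly ring" where "S \<equiv> mpoly_ring n"
abbreviation (input) T :: "'k mpoly ring" where "T \<equiv> mpoly_ring (n - 1)"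

lemma subst_ring_hom: "\<phi> \<in> ring_hom S T"
  using hom by (simp add: algebra_hom_def)

lemma subst_mconst: "\<phi> (mconst c) = mconst c"
  using hom by (simp add: algebra_hom_def)

lemma subst_0: "\<phi> 0 = 0"
  using subst_mconst[of 0] by (simp add: mconst_def)

lemma subst_1: "\<phi> 1 = 1"
  using subst_mconst[of 1] by (simp add: mconst_def)

lemma subst_closed: "p \<in> carrier S \<Longrightarrow> \<phi> p \<in> carrier T"
  by (rule ring_hom_closed[OF subst_ring_hom])

lemma subst_add: "p \<in> carrier S \<Longrightarrow> q \<in> carrier S \<Longrightarrow> \<phi> (p + q) = \<phi> p + \<phi> q"
  using ring_hom_add[OF subst_ring_hom, of p q] by simp

lemma subst_mult: "p \<in> carrier S \<Longrightarrow> q \<in> carrier S \<Longrightarrow> \<phi> (p * q) = \<phi> p * \<phi> q"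
  using ring_hom_mult[OF subst_ring_hom, of p q] by simp

text \<open>Membership is carried through the induction because additivity of \<open>\<phi>\<close>
  is available only on the carrier of \<open>S\<close>.\<close>

lemma subst_sum:
  assumes "finite A" "\<And>x. x \<in> A \<Longrightarrow> g x \<in> carrier S"
  shows "sum g A \<in> carrier S \<and> \<phi> (sum g A) = (\<Sum>x\<in>A. \<phi> (g x))"
  using assms
proof (induction A rule: finite_induct)
  case empty
  then show ?case by (simp add: subst_0)
next
  case (insert x A)
  then have IH: "sum g A \<in> carrier S" "\<phi> (sum g A) = (\<Sum>x\<in>A. \<phi> (g x))" and gx: "g x \<in> carrier S"
    by blast+
  show ?case
    using subst_add[OF gx IH(1)] mpoly_ring_closed(1)[OF gx IH(1)] insert(1,2)
    by (simp only: sum.insert IH(2) simp_thms)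
qed

lemma subst_monomial_var_power:
  assumes "i \<in> {1..n}"
  shows "\<phi> (monomial (Poly_Mapping.single i k)) = monomial (drop_var n (Poly_Mapping.single i k))"
proof (induction k)
  case 0
  then show ?case by (simp add: drop_var_0 monomial_0 subst_1)
next
  case (Suc k)
  let ?u = "Poly_Mapping.single i k" and ?v = "Poly_Mapping.single i (Suc 0)"
  have Suc_k: "Poly_Mapping.single i (Suc k) = ?v + ?u" by (simp flip: single_add)
  have "?u \<in> exponents n" using assms by (simp add: exponents_def)
  moreover have "\<phi> (mvar i) = monomial (drop_var n ?v)"
  proof (cases "i = n")
    case True
    then show ?thesis using last_var by (simp add: drop_var_single monomial_0)
  next
    case False
    then have "i \<in> {1..n - 1}" using assms by auto
    then show ?thesis using fix_vars False by (simp add: drop_var_single mvar_eq_monomial)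
  qed
  ultimately show ?case
    unfolding Suc_k drop_var_add monomial_add
    using subst_mult[OF mvar_in_mpoly_ring[OF assms] monomial_in_mpoly_ring[of ?u n]] Suc
    by (simp add: mvar_eq_monomial)
qed

text \<open>Induction on the support: each step adds a power of one new variable, so the monomial
  splits as a product.\<close>

lemma subst_monomial:
  assumes "m \<in> exponents n"
  shows "\<phi> (monomial m) = monomial (drop_var n m)"
  using assms
proof (induction m rule: update_induct)
  case const
  then show ?case by (simp add: drop_var_0 monomial_0 subst_1)
next
  case (update f i k)
  have eq: "Poly_Mapping.update i k f = f + Poly_Mapping.single i k"
    using update(1)
    by (intro poly_mapping_eqI) (auto simp: update.rep_eq lookup_add lookup_single when_def in_keys_iff)
  have "Poly_Mapping.keys (Poly_Mapping.update i k f) = insert i (Poly_Mapping.keys f)"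
    using update(2) by (auto simp: in_keys_iff update.rep_eq split: if_splits)
  then have f: "f \<in> exponents n" and i: "i \<in> {1..n}"
    using update(4) by (auto simp: exponents_def)
  have "Poly_Mapping.single i k \<in> exponents n" using i by (simp add: exponents_def)
  then show ?case
    unfolding eq drop_var_add monomial_add
    using subst_mult[OF monomial_in_mpoly_ring[OF f] monomial_in_mpoly_ring[of "Poly_Mapping.single i k"]]
      update(3)[OF f] subst_monomial_var_power[OF i] by simp
qed

lemma subst_expand:
  assumes p: "p \<in> carrier S"
  shows "\<phi> p = (\<Sum>m\<in>Poly_Mapping.keys p. Poly_Mapping.single (drop_var n m) (Poly_Mapping.lookup p m))"
proof -
  have single: "\<phi> (Poly_Mapping.single m c) = Poly_Mapping.single (drop_var n m) c"
    if "m \<in> exponents n" for m c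
    using subst_mult[OF mconst_in_mpoly_ring monomial_in_mpoly_ring[OF that], of c]
    by (simp add: subst_mconst subst_monomial[OF that] mconst_mult_monomial)
  have keys: "m \<in> exponents n" if "m \<in> Poly_Mapping.keys p" for m
    using p that by auto
  have "\<phi> p = \<phi> (\<Sum>m\<in>Poly_Mapping.keys p. Poly_Mapping.single m (Poly_Mapping.lookup p m))"
    by (simp flip: mpoly_expand)
  also have "\<dots> = (\<Sum>m\<in>Poly_Mapping.keys p. \<phi> (Poly_Mapping.single m (Poly_Mapping.lookup p m)))"
    by (rule subst_sum[THEN conjunct2, OF finite_keys single_in_mpoly_ring[OF keys]])
  also have "\<dots> = (\<Sum>m\<in>Poly_Mapping.keys p. Poly_Mapping.single (drop_var n m) (Poly_Mapping.lookup p m))"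
    by (rule sum.cong[OF refl single[OF keys]])
  finally show ?thesis .
qed

text \<open>Only an inclusion: monomials that differ just in the power of \<open>x_n\<close> have
  the same image, and their coefficients may cancel.\<close>

lemma keys_subst:
  assumes "p \<in> carrier S"
  shows "Poly_Mapping.keys (\<phi> p) \<subseteq> drop_var n ` Poly_Mapping.keys p"
proof -
  have "Poly_Mapping.keys (\<phi> p) \<subseteq> (\<Union>m\<in>Poly_Mapping.keys p.
      Poly_Mapping.keys (Poly_Mapping.single (drop_var n m) (Poly_Mapping.lookup p m)))"
    unfolding subst_expand[OF assms] by (rule Poly_Mapping.keys_sum)
  then show ?thesis by (auto split: if_splits)
qed

text \<open>As \<open>T\<close> is a subset of \<open>S\<close>, this makes \<open>\<phi>\<close> a
  retraction of \<open>S\<close> onto \<open>T\<close>.\<close>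

lemma subst_id:
  assumes "p \<in> carrier T"
  shows "\<phi> p = p"
proof -
  have "\<phi> p = (\<Sum>m\<in>Poly_Mapping.keys p. Poly_Mapping.single m (Poly_Mapping.lookup p m))"
    unfolding subst_expand[OF mpoly_ring_mono[OF assms]] using assms n
    by (intro sum.cong) (auto simp: drop_var_id)
  then show ?thesis by (simp flip: mpoly_expand)
qed

lemma subst_image_carrier: "\<phi> ` carrier S = carrier T"
proof
  show "\<phi> ` carrier S \<subseteq> carrier T" using subst_closed by blast
  show "carrier T \<subseteq> \<phi> ` carrier S"
    using subst_id mpoly_ring_mono by (metis image_eqI subsetI)
qed

section \<open>Images, preimages and extensions of ideals\<close>

lemma subst_image_ideal:
  assumes "ideal N S"
  shows "ideal (\<phi> ` N) T"
proof (rule ideal_mpoly_ringI)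
  note N = ideal_mpoly_ringD[OF assms]
  show "\<phi> ` N \<subseteq> carrier T" using N(1) subst_closed by blast
  show "0 \<in> \<phi> ` N" using N(2) subst_0 by force
  fix p q assume "p \<in> \<phi> ` N" "q \<in> \<phi> ` N"
  then obtain p' q' where "p' \<in> N" "p = \<phi> p'" "q' \<in> N" "q = \<phi> q'" by blast
  moreover from this have "\<phi> (p' + q') = p + q" using subst_add N(1) by blast
  ultimately show "p + q \<in> \<phi> ` N" using N(3) by (metis image_eqI)
next
  note N = ideal_mpoly_ringD[OF assms]
  fix r p assume r: "r \<in> carrier T" and "p \<in> \<phi> ` N"
  then obtain p' where p': "p' \<in> N" "p = \<phi> p'" by blast
  have "\<phi> (r * p') = r * p"
    using subst_mult[OF mpoly_ring_mono[OF r]] p' N(1) subst_id[OF r] by auto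
  then show "r * p \<in> \<phi> ` N" using N(4)[OF mpoly_ring_mono[OF r] p'(1)] by (metis image_eqI)
qed

lemma subst_vimage_ideal:
  assumes "ideal N T"
  shows "ideal {p \<in> carrier S. \<phi> p \<in> N} S"
proof (rule ideal_mpoly_ringI)
  note N = ideal_mpoly_ringD[OF assms]
  show "{p \<in> carrier S. \<phi> p \<in> N} \<subseteq> carrier S" by blast
  show "0 \<in> {p \<in> carrier S. \<phi> p \<in> N}" using N(2) by (simp add: subst_0)
  show "p + q \<in> {p \<in> carrier S. \<phi> p \<in> N}"
    if "p \<in> {p \<in> carrier S. \<phi> p \<in> N}" "q \<in> {p \<in> carrier S. \<phi> p \<in> N}" for p q
    using that mpoly_ring_closed(1)[of p n q] N(3)[of "\<phi> p" "\<phi> q"] subst_add[of p q] by auto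
  show "r * p \<in> {p \<in> carrier S. \<phi> p \<in> N}"
    if "r \<in> carrier S" "p \<in> {p \<in> carrier S. \<phi> p \<in> N}" for r p
    using that mpoly_ring_closed(3)[of r n p] N(4)[OF subst_closed[of r], of "\<phi> p"] subst_mult[of r p]
    by auto
qed

lemma subst_genideal:
  assumes A: "A \<subseteq> carrier S"
  shows "\<phi> ` genideal S A = genideal T (\<phi> ` A)"
proof
  have A': "\<phi> ` A \<subseteq> carrier T" using A subst_closed by blast
  have "genideal S A \<subseteq> {p \<in> carrier S. \<phi> p \<in> genideal T (\<phi> ` A)}"
    using A genideal_mpoly_ring(2)[OF A']
    by (intro genideal_mpoly_ring(3)[OF A] subst_vimage_ideal[OF genideal_mpoly_ring(1)[OF A']]) blast
  then show "\<phi> ` genideal S A \<subseteq> genideal T (\<phi> ` A)" by blast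
  show "genideal T (\<phi> ` A) \<subseteq> \<phi> ` genideal S A"
    using genideal_mpoly_ring(2)[OF A]
    by (intro genideal_mpoly_ring(3)[OF A'] subst_image_ideal[OF genideal_mpoly_ring(1)[OF A]]) blast
qed

lemma subst_monomial_ideal:
  assumes "monomial_ideal n N"
  shows "monomial_ideal (n - 1) (\<phi> ` N)"
proof -
  obtain A where A: "A \<subseteq> monomial ` exponents n" "N = genideal S A"
    using assms unfolding monomial_ideal_def by blast
  have A_carrier: "A \<subseteq> carrier S" using A(1) monomial_in_mpoly_ring by blast
  have "\<phi> ` A \<subseteq> monomial ` exponents (n - 1)"
    using A(1) subst_monomial drop_var_exponents by fastforce
  then show ?thesis
    unfolding monomial_ideal_def A(2) subst_genideal[OF A_carrier] by blast
qed

text \<open>\<open>\<phi>\<close> fixes the generators, so extending \<open>N\<close> to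
  \<open>S\<close> and substituting gives back \<open>N\<close>. This yields both the uniqueness of
  \<open>P'\<close> and the passage between \<open>P\<close> and \<open>P'\<close> on elements of
  \<open>T\<close>.\<close>

lemma subst_extended_ideal:
  assumes N: "ideal N T"
  shows "\<phi> ` genideal S N = N" "\<And>t. t \<in> carrier T \<Longrightarrow> t \<in> genideal S N \<longleftrightarrow> t \<in> N"
proof -
  have NT: "N \<subseteq> carrier T" by (rule ideal_mpoly_ringD(1)[OF N])
  then have NS: "N \<subseteq> carrier S" using mpoly_ring_mono by blast
  have "\<phi> ` N = N" using NT subst_id by force
  moreover have "genideal T N = N"
    by (intro equalityI genideal_mpoly_ring(2,3)[OF NT] N order_refl)
  ultimately show image: "\<phi> ` genideal S N = N"
    by (simp only: subst_genideal[OF NS])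
  show "t \<in> genideal S N \<longleftrightarrow> t \<in> N" if "t \<in> carrier T" for t
  proof
    assume "t \<in> genideal S N"
    then have "\<phi> t \<in> \<phi> ` genideal S N" by (rule imageI)
    then show "t \<in> N" unfolding image subst_id[OF that] .
  qed (use genideal_mpoly_ring(2)[OF NS] in blast)
qed

lemma subst_monomial_prime_ideal:
  assumes P: "monomial_prime_ideal n P" and last: "mvar n \<notin> P"
  shows "monomial_prime_ideal (n - 1) (\<phi> ` P)" "P = genideal S (\<phi> ` P)"
proof -
  obtain A where A: "A \<subseteq> {1..n}" "P = genideal S (mvar ` A)"
    using P unfolding monomial_prime_ideal_def by blast
  interpret P: primeideal P S using P by (simp add: monomial_prime_ideal_def)
  have AS: "mvar ` A \<subseteq> carrier S" using A(1) mvar_in_mpoly_ring by blast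
  have AP: "mvar ` A \<subseteq> P" unfolding A(2) by (rule genideal_mpoly_ring(2)[OF AS])
  have A': "A \<subseteq> {1..n - 1}"
  proof
    fix i assume i: "i \<in> A"
    then have "i \<noteq> n" using AP last by blast
    then show "i \<in> {1..n - 1}" using A(1) i by fastforce
  qed
  have AT: "mvar ` A \<subseteq> carrier T" using A' mvar_in_mpoly_ring by blast
  have image_mvar: "\<phi> ` mvar ` A = mvar ` A" using A' fix_vars by force
  have image: "\<phi> ` P = genideal T (mvar ` A)"
    unfolding A(2) subst_genideal[OF AS] image_mvar ..
  note I = ideal_mpoly_ringD[OF P.is_ideal]
  have "ideal (P \<inter> carrier T) T"
  proof (rule ideal_mpoly_ringI)
    show "P \<inter> carrier T \<subseteq> carrier T" by blast
    show "0 \<in> P \<inter> carrier T" using I(2) by simp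
    show "p + q \<in> P \<inter> carrier T" if "p \<in> P \<inter> carrier T" "q \<in> P \<inter> carrier T" for p q
      using that I(3) mpoly_ring_closed(1)[of p "n - 1" q] by blast
    show "r * p \<in> P \<inter> carrier T" if "r \<in> carrier T" "p \<in> P \<inter> carrier T" for r p
      using that I(4)[OF mpoly_ring_mono] mpoly_ring_closed(3)[of r "n - 1" p] by blast
  qed
  then have "\<phi> ` P \<subseteq> P \<inter> carrier T"
    unfolding image by (rule genideal_mpoly_ring(3)[OF AT]) (use AP AT in blast)
  moreover have "P \<inter> carrier T \<subseteq> \<phi> ` P" using subst_id by force
  ultimately have contract: "\<phi> ` P = P \<inter> carrier T" by blast
  have "primeideal (\<phi> ` P) T"
  proof (rule primeidealI)
    show "ideal (\<phi> ` P) T" by (rule subst_image_ideal[OF P.is_ideal])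
    show "cring T" by (rule cring_mpoly_ring)
    have "1 \<in> carrier T" by simp
    then show "carrier T \<noteq> \<phi> ` P"
      unfolding contract using one_notin_primeideal[OF P.primeideal_axioms] by blast
    show "p \<in> \<phi> ` P \<or> q \<in> \<phi> ` P"
      if "p \<in> carrier T" "q \<in> carrier T" "p \<otimes>\<^bsub>T\<^esub> q \<in> \<phi> ` P" for p q
      using that P.I_prime[OF mpoly_ring_mono mpoly_ring_mono, of p q] unfolding contract by auto
  qed
  then show "monomial_prime_ideal (n - 1) (\<phi> ` P)"
    unfolding monomial_prime_ideal_def using A' image by blast
  have PS: "\<phi> ` P \<subseteq> carrier S" using contract I(1) by blast
  show "P = genideal S (\<phi> ` P)"
  proof
    have "mvar ` A \<subseteq> \<phi> ` P" unfolding contract using AP AT by blast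
    also have "\<dots> \<subseteq> genideal S (\<phi> ` P)" by (rule genideal_mpoly_ring(2)[OF PS])
    finally show "P \<subseteq> genideal S (\<phi> ` P)"
      using genideal_mpoly_ring(3)[OF AS genideal_mpoly_ring(1)[OF PS]] A(2) by blast
    show "genideal S (\<phi> ` P) \<subseteq> P"
      by (rule genideal_mpoly_ring(3)[OF PS P.is_ideal]) (use contract in blast)
  qed
qed

section \<open>One filtration step under the substitution\<close>

text \<open>Primality removes the factors \<open>x_n\<close> one at a time.\<close>

lemma primeideal_cancel_last_var:
  assumes P: "primeideal P S" and last: "mvar n \<notin> P" and u: "u \<in> exponents n"
    and mem: "monomial (Poly_Mapping.single n k + u) \<in> P"
  shows "monomial u \<in> P"
  using mem
proof (induction k)
  case (Suc k)
  interpret P: primeideal P S by (rule P)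
  let ?v = "Poly_Mapping.single n k + u"
  have "?v \<in> exponents n"
    using u n by (intro exponents_add) (simp_all add: exponents_def)
  moreover have "Poly_Mapping.single n (Suc k) + u = Poly_Mapping.single n (Suc 0) + ?v"
    by (simp flip: add.assoc single_add)
  then have "mvar n \<otimes>\<^bsub>S\<^esub> monomial ?v \<in> P"
    using Suc.prems by (simp add: mvar_eq_monomial flip: monomial_add)
  ultimately have "monomial ?v \<in> P"
    using P.I_prime[OF mvar_in_mpoly_ring monomial_in_mpoly_ring, of n ?v] last n by auto
  then show ?case by (rule Suc.IH)
qed simp

text \<open>Apply \<open>\<phi>\<close> to the relation in \<open>F\<close>; the new coefficient is
  \<open>\<phi> s\<close>. Both cases of the theorem use this.\<close>

lemma cyclic_step_gen_image:
  assumes F: "F \<subseteq> carrier S" and G: "G \<subseteq> carrier S" and step: "cyclic_step n F G P m" and q: "q \<in> \<phi> ` F"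
  shows "\<exists>s\<in>carrier T. q - s * monomial (drop_var n m) \<in> \<phi> ` G"
proof -
  obtain q' where q': "q' \<in> F" "q = \<phi> q'" using q by blast
  obtain s where s: "s \<in> carrier S" "q' - s * monomial m \<in> G"
    using step q'(1) unfolding cyclic_step_def by blast
  have m: "m \<in> exponents n" using step unfolding cyclic_step_def by blast
  have sm: "s * monomial m \<in> carrier S"
    by (rule mpoly_ring_closed(3)[OF s(1) monomial_in_mpoly_ring[OF m]])
  have "q = \<phi> ((q' - s * monomial m) + s * monomial m)" by (simp add: q'(2))
  also have "\<dots> = \<phi> (q' - s * monomial m) + \<phi> s * monomial (drop_var n m)"
    using subst_add[OF subsetD[OF G s(2)] sm] subst_mult[OF s(1) monomial_in_mpoly_ring[OF m]]
    by (simp only: subst_monomial[OF m])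
  finally have "q - \<phi> s * monomial (drop_var n m) \<in> \<phi> ` G" using s(2) by simp
  then show ?thesis using subst_closed[OF s(1)] by blast
qed

text \<open>Stated for an arbitrary ideal \<open>P'\<close> of \<open>T\<close> extending to
  \<open>P\<close>, so that it applies to every \<open>P'\<close> over which the theorem
  quantifies.\<close>

lemma subst_cyclic_step:
  assumes F: "ideal F S" and G: "monomial_ideal n G" and P: "primeideal P S" "mvar n \<notin> P"
    and step: "cyclic_step n F G P m" and P': "ideal P' T" "P = genideal S P'"
  shows "cyclic_step (n - 1) (\<phi> ` F) (\<phi> ` G) P' (drop_var n m)"
proof -
  let ?c = "monomial (drop_var n m) :: 'k mpoly"
  have m: "m \<in> exponents n" and mF: "monomial m \<in> F"
    and colon: "\<And>s. s \<in> carrier S \<Longrightarrow> s * monomial m \<in> G \<longleftrightarrow> s \<in> P"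
    using step unfolding cyclic_step_def by blast+
  note GI = ideal_mpoly_ringD[OF ideal_of_monomial_ideal[OF G]]
  have "t \<in> P'" if t: "t \<in> carrier T" and tc: "t * ?c \<in> \<phi> ` G" for t
  proof -
    \<comment> \<open>It suffices to work in \<open>P\<close>, because \<open>t\<close> lies in
      \<open>T\<close> and \<open>P\<close> contracts to \<open>P'\<close>. There the monomials of
      \<open>t\<close> can be treated separately.\<close>
    have "t \<in> P"
    proof (rule ideal_of_monomials[OF primeideal.axioms(1)[OF P(1)]])
      fix u assume u: "u \<in> Poly_Mapping.keys t"
      have uT: "u \<in> exponents (n - 1)" using t u by auto
      have "u + drop_var n m \<in> Poly_Mapping.keys (t * ?c)"
        using u by (simp add: in_keys_iff lookup_mult_monomial)
      moreover obtain q where q: "q \<in> G" "t * ?c = \<phi> q" using tc by blast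
      moreover have "q \<in> carrier S" using q GI(1) by blast
      ultimately obtain v where v: "v \<in> Poly_Mapping.keys q" "u + drop_var n m = drop_var n v"
        using keys_subst[of q] by auto
      have vG: "monomial v \<in> G" by (rule monomial_ideal_keys[OF G q(1) v(1)])
      txt \<open>\<open>u + m\<close> and \<open>v\<close> agree outside \<open>x\<^sub>n\<close>, so a power of \<open>x\<^sub>n\<close> moves \<open>x\<^bsup>u+m\<^esup>\<close> into \<open>G\<close>.\<close>
      let ?k = "Poly_Mapping.single n (Poly_Mapping.lookup v n)"
      let ?w = "Poly_Mapping.single n (Poly_Mapping.lookup m n)"
      have eq: "(?k + u) + m = ?w + v"
      proof (rule poly_mapping_eqI)
        fix i
        show "Poly_Mapping.lookup ((?k + u) + m) i = Poly_Mapping.lookup (?w + v) i"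
          using arg_cong[OF v(2), of "\<lambda>w. Poly_Mapping.lookup w i"] lookup_last_exponent[OF n uT]
          by (cases "i = n") (simp_all add: lookup_add lookup_single lookup_drop_var)
      qed
      have "?w \<in> exponents n" "?k \<in> exponents n" using n by (simp_all add: exponents_def)
      moreover have uS: "u \<in> exponents n" by (rule exponents_mono[OF uT])
      \<comment> \<open>By \<open>eq\<close>, the product of \<open>monomial (?k + u)\<close> and
        \<open>monomial m\<close> is a multiple of \<open>monomial v\<close>, so it lies in
        \<open>G\<close> and the colon condition applies.\<close>
      ultimately have "monomial (?k + u) \<in> P"
        using colon[OF monomial_in_mpoly_ring[OF exponents_add, of ?k n u]]
          GI(4)[OF monomial_in_mpoly_ring[of ?w n] vG] by (simp add: eq flip: monomial_add)
      then show "monomial u \<in> P" by (rule primeideal_cancel_last_var[OF P uS])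
    qed
    then show ?thesis using subst_extended_ideal(2)[OF P'(1) t] P'(2) by simp
  qed
  moreover have "t * ?c \<in> \<phi> ` G" if t: "t \<in> carrier T" and tP: "t \<in> P'" for t
  proof -
    have "t * monomial m \<in> G"
      using colon[OF mpoly_ring_mono[OF t]] subst_extended_ideal(2)[OF P'(1) t] P'(2) tP by simp
    moreover have "\<phi> (t * monomial m) = t * ?c"
      using subst_mult[OF mpoly_ring_mono[OF t] monomial_in_mpoly_ring[OF m]]
      by (simp only: subst_id[OF t] subst_monomial[OF m])
    ultimately show ?thesis by (metis image_eqI)
  qed
  moreover have "?c \<in> \<phi> ` F" using mF subst_monomial[OF m] by (metis image_eqI)
  ultimately show ?thesis
    unfolding cyclic_step_def
    using drop_var_exponents[OF m] cyclic_step_gen_image[OF ideal_mpoly_ringD(1)[OF F] GI(1) step] by blast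
qed

text \<open>\<open>x_n * x^m\<close> lies in \<open>G\<close>, and its image is that of
  \<open>x^m\<close> because \<open>x_n\<close> maps to 1. So the extra generator of
  \<open>F\<close> already lies in the image of \<open>G\<close>.\<close>

lemma subst_image_eq_of_cyclic_step:
  assumes F: "ideal F S" and G: "ideal G S" "G \<subseteq> F" and last: "mvar n \<in> P" and step: "cyclic_step n F G P m"
  shows "\<phi> ` F = \<phi> ` G"
proof
  have m: "m \<in> exponents n" using step unfolding cyclic_step_def by blast
  have var: "mvar n \<in> carrier S" using n by (intro mvar_in_mpoly_ring) simp
  note GI = ideal_mpoly_ringD[OF subst_image_ideal[OF G(1)]]
  have "mvar n * monomial m \<in> G" using step last var unfolding cyclic_step_def by blast
  moreover have "\<phi> (mvar n * monomial m) = monomial (drop_var n m)"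
    using subst_mult[OF var monomial_in_mpoly_ring[OF m]] by (simp add: last_var subst_monomial[OF m])
  ultimately have mem: "monomial (drop_var n m) \<in> \<phi> ` G" by (metis image_eqI)
  show "\<phi> ` F \<subseteq> \<phi> ` G"
  proof
    fix q assume "q \<in> \<phi> ` F"
    then obtain s where s: "s \<in> carrier T" "q - s * monomial (drop_var n m) \<in> \<phi> ` G"
      using cyclic_step_gen_image[OF ideal_mpoly_ringD(1)[OF F] ideal_mpoly_ringD(1)[OF G(1)] step] by blast
    show "q \<in> \<phi> ` G" using GI(3)[OF s(2) GI(4)[OF s(1) mem]] by simp
  qed
  show "\<phi> ` G \<subseteq> \<phi> ` F" using G(2) by blast
qed

end

theorem proposition2p1:
  fixes n r :: nat
    and \<phi> :: "'k::field mpoly \<Rightarrow> 'k mpoly"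
    and I :: "'k mpoly set"
    and F P :: "nat \<Rightarrow> 'k mpoly set"
    and a :: "nat \<Rightarrow> (nat \<Rightarrow>\<^sub>0 int)"
  assumes "n \<ge> 1"
    and "\<phi> \<in> algebra_hom n (n - 1)"
    and "\<forall>i\<in>{1..n-1}. \<phi> (mvar i) = mvar i"
    and "\<phi> (mvar n) = 1"
    and "monomial_ideal n I"
    and "prime_filtration n I r F P a"
  shows "\<phi> ` I = \<phi> ` F 0
    \<and> (\<forall>j\<in>{1..r}. \<phi> ` F (j - 1) \<subseteq> \<phi> ` F j)
    \<and> \<phi> ` F r = carrier (mpoly_ring (n - 1))
    \<and> (\<forall>j\<le>r. monomial_ideal (n - 1) (\<phi> ` F j))
    \<and> (\<forall>j\<in>{1..r}.
        (mvar n \<notin> P j \<longrightarrow>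
          (\<exists>!P'. monomial_prime_ideal (n - 1) P' \<and> P j = genideal (mpoly_ring n) P') \<and>
          (\<forall>P'. monomial_prime_ideal (n - 1) P' \<and> P j = genideal (mpoly_ring n) P' \<longrightarrow>
            graded_iso (n - 1)
              (quotient_module (ideal_module (\<phi> ` F j)) (\<phi> ` F (j - 1)))
              (cyclic_module (n - 1) P' (drop_coord n (a j))))) \<and>
        (mvar n \<in> P j \<longrightarrow>
          graded_iso (n - 1)
            (quotient_module (ideal_module (\<phi> ` F j)) (\<phi> ` F (j - 1)))
            zero_module))"
proof -
  note n = assms(1) and subst = assms(1-4)
  have F: "F 0 = I" "F r = carrier (mpoly_ring n)" "\<And>j. j \<le> r \<Longrightarrow> monomial_ideal n (F j)"
    using assms(6) unfolding prime_filtration_def by blast+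
  have subset: "F (j - 1) \<subseteq> F j" if "j \<in> {1..r}" for j
    using assms(6) that unfolding prime_filtration_def by blast
  have main: "(mvar n \<notin> P j \<longrightarrow>
          (\<exists>!P'. monomial_prime_ideal (n - 1) P' \<and> P j = genideal (mpoly_ring n) P') \<and>
          (\<forall>P'. monomial_prime_ideal (n - 1) P' \<and> P j = genideal (mpoly_ring n) P' \<longrightarrow>
            graded_iso (n - 1)
              (quotient_module (ideal_module (\<phi> ` F j)) (\<phi> ` F (j - 1)))
              (cyclic_module (n - 1) P' (drop_coord n (a j))))) \<and>
        (mvar n \<in> P j \<longrightarrow>
          graded_iso (n - 1)
            (quotient_module (ideal_module (\<phi> ` F j)) (\<phi> ` F (j - 1)))
            zero_module)" if j: "j \<in> {1..r}" for j
  proof -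
    have step_data: "monomial_prime_ideal n (P j)" "a j \<in> degrees n"
      "graded_iso n (quotient_module (ideal_module (F j)) (F (j - 1))) (cyclic_module n (P j) (a j))"
      using assms(6) j unfolding prime_filtration_def by blast+
    have G: "monomial_ideal n (F (j - 1))" using j by (intro F(3)) auto
    have FJ: "monomial_ideal n (F j)" using j by (intro F(3)) auto
    note GI = ideal_of_monomial_ideal[OF G] and FI = ideal_of_monomial_ideal[OF FJ]
    have prime: "primeideal (P j) (mpoly_ring n)"
      using step_data(1) unfolding monomial_prime_ideal_def by blast
    \<comment> \<open>The degree \<open>a j\<close> is realised by an exponent vector
      \<open>m\<close>; from here on only the monomial \<open>x^m\<close> matters.\<close>
    obtain m where m: "Poly_Mapping.map int m = a j" "cyclic_step n (F j) (F (j - 1)) (P j) m"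
      by (rule cyclic_step_of_graded_iso[OF FI GI primeideal.axioms(1)[OF prime]
            one_notin_primeideal[OF prime] step_data(2,3)])
    have "graded_iso (n - 1) (quotient_module (ideal_module (\<phi> ` F j)) (\<phi> ` F (j - 1)))
        (cyclic_module (n - 1) P' (drop_coord n (a j)))"
      if "mvar n \<notin> P j" "monomial_prime_ideal (n - 1) P'" "P j = genideal (mpoly_ring n) P'" for P'
    proof -
      have P': "ideal P' (mpoly_ring (n - 1))"
        using that(2) unfolding monomial_prime_ideal_def by (blast dest: primeideal.axioms(1))
      show ?thesis
        unfolding m(1)[symmetric] drop_coord_map_int
        by (rule graded_iso_of_cyclic_step[OF subst_image_ideal[OF subst FI]
              subst_monomial_ideal[OF subst G] image_mono[OF subset[OF j]] P'
              subst_cyclic_step[OF subst FI G prime that(1) m(2) P' that(3)]])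
    qed
    moreover have "\<exists>!P'. monomial_prime_ideal (n - 1) P' \<and> P j = genideal (mpoly_ring n) P'"
      if "mvar n \<notin> P j"
    proof (rule ex1I[of _ "\<phi> ` P j"])
      show "monomial_prime_ideal (n - 1) (\<phi> ` P j) \<and> P j = genideal (mpoly_ring n) (\<phi> ` P j)"
        using subst_monomial_prime_ideal[OF subst step_data(1) that] by blast
      fix P' assume P': "monomial_prime_ideal (n - 1) P' \<and> P j = genideal (mpoly_ring n) P'"
      then have "ideal P' (mpoly_ring (n - 1))"
        unfolding monomial_prime_ideal_def by (blast dest: primeideal.axioms(1))
      from subst_extended_ideal(1)[OF subst this] P' show "P' = \<phi> ` P j" by simp
    qed
    moreover have "graded_iso (n - 1) (quotient_module (ideal_module (\<phi> ` F j)) (\<phi> ` F (j - 1))) zero_module"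
      if "mvar n \<in> P j"
      unfolding subst_image_eq_of_cyclic_step[OF subst FI GI subset[OF j] that m(2)]
      by (rule graded_iso_zero_module[OF subst_image_ideal[OF subst GI]])
    ultimately show ?thesis by blast
  qed
  show ?thesis
  proof (intro conjI ballI allI impI)
    show "\<phi> ` I = \<phi> ` F 0" by (simp only: F(1))
    show "\<phi> ` F r = carrier (mpoly_ring (n - 1))"
      unfolding F(2) by (rule subst_image_carrier[OF subst])
    show "\<phi> ` F (j - 1) \<subseteq> \<phi> ` F j" if "j \<in> {1..r}" for j
      by (rule image_mono[OF subset[OF that]])
    show "monomial_ideal (n - 1) (\<phi> ` F j)" if "j \<le> r" for j
      by (rule subst_monomial_ideal[OF subst F(3)[OF that]])
  qed (use main in blast)+
qed

end
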